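(* Let $A,B\in\mathrm{GL}(n,\mathbb{Z})$ be hyperbolic with the same irreducible characteristic polynomial $p(x)\in\mathbb{Z}[x]$, let $\beta$ be a fixed root of $p(x)$, and let $I$ and $J$ be the fractional ideals of $\mathbb{Z}[\beta]$ associated to $A$ and $B$ respectively. Suppose that $I$ and $J$ have the same ring of coefficients $\mathfrak{O}$. If $I$ and $J$ are weakly equivalent, then $A$ and $B$ are strongly BF-equivalent.
   Context: A matrix in $\mathrm{GL}(n,\mathbb{Z})$ is hyperbolic if it has no eigenvalue of modulus $1$. Put $R=\mathbb{Z}[x]/(p(x))$, identified with $\mathbb{Z}[\beta]$, and $\mathbb{K}=\mathbb{Q}(\beta)$. A fractional ideal of $\mathbb{Z}[\beta]$ is a finitely generated $\mathbb{Z}[\beta]$-module contained in $\mathbb{K}$. The fractional ideal $I$ associated to $A$ is obtained by choosing a row eigenvector $v$ of $A$ for $\beta$, i.e. $vA=\beta v$, with entries in $\mathbb{K}$ such that the components of $v$ form a $\mathbb{Z}$-basis of a fractional ideal $I$ of $\mathbb{Z}[\beta]$; it is determined up to multiplication by a nonzero element of $\mathbb{K}$. Likewise $J$ is the fractional ideal of $\mathbb{Z}[\beta]$ having as $\mathbb{Z}$-basis the components of a row eigenvector $w$ with $wB=\beta w$. The ring of coefficients of $I$ is $\mathfrak{O}(I)=\{z\in\mathbb{K}: zI\subset I\}$, and similarly for $J$. When $\mathfrak{O}(I)=\mathfrak{O}(J)=\mathfrak{O}$, the ideals $I$ and $J$ are called weakly equivalent if there are finitely generated $\mathfrak{O}$-modules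 $X,Y\subset\mathbb{K}$ such that $IX=J$ and $JY=I$ (the product of two modules being the additive group generated by products of their elements). Regard $\mathbb{Z}^n$ as row vectors, with $A$ and $B$ acting on the right. For $g\in\mathbb{Z}[x]$ with $g(A)$ invertible (i.e. $\det g(A)\neq 0$; equivalently $\det g(B)\ne 0$), set $\mathrm{BF}_g(A)=\mathbb{Z}^n/\mathbb{Z}^n g(A)$ and $\mathrm{BF}_g(B)=\mathbb{Z}^n/\mathbb{Z}^n g(B)$. These are $R$-modules, with the class of $x$ acting by $m\mapsto mA$, respectively $m\mapsto mB$. The matrices $A$ and $B$ are strongly BF-equivalent if $\mathrm{BF}_g(A)$ and $\mathrm{BF}_g(B)$ are isomorphic as $R$-modules for every $g\in\mathbb{Z}[x]$ with $g(A)$ invertible. *)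

theory Defs
  imports
    "HOL-Computational_Algebra.Group_Closure"
    "HOL-Algebra.QuotRing"
    "Jordan_Normal_Form.VS_Connect"
    "Jordan_Normal_Form.Char_Poly"
begin

definition GL_int :: "nat \<Rightarrow> int mat set" where
  "GL_int n = {A \<in> carrier_mat n n. invertible_mat A}"

definition hyperbolic :: "int mat \<Rightarrow> bool" where
  "hyperbolic A \<longleftrightarrow>
     (\<forall>k :: complex. eigenvalue (map_mat of_int A) k \<longrightarrow> cmod k \<noteq> 1)"

definition Z_adjoin :: "complex \<Rightarrow> complex set" where
  "Z_adjoin \<beta> = {poly (map_poly of_int f) \<beta> | f :: int poly. True}"

definition Q_field :: "complex \<Rightarrow> complex set" where
  "Q_field \<beta> = {poly (map_poly of_rat f) \<beta> / poly (map_poly of_rat g) \<beta> | f g :: rat poly.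
     poly (map_poly of_rat g) \<beta> \<noteq> 0}"

text \<open>In the next definition \<open>S\<close> is meant to be a subring of the complex numbers.\<close>

definition fg_module :: "complex set \<Rightarrow> complex set \<Rightarrow> bool" where
  "fg_module S X \<longleftrightarrow>
     (\<exists>G. finite G \<and> X = {\<Sum>g\<in>G. c g * g | c. \<forall>g\<in>G. c g \<in> S})"

definition fractional_ideal :: "complex \<Rightarrow> complex set \<Rightarrow> bool" where
  "fractional_ideal \<beta> I \<longleftrightarrow> fg_module (Z_adjoin \<beta>) I \<and> I \<subseteq> Q_field \<beta>"

definition Z_basis :: "complex vec \<Rightarrow> complex set \<Rightarrow> bool" where
  "Z_basis v I \<longleftrightarrow>
     (\<forall>c :: nat \<Rightarrow> int. (\<Sum>i<dim_vec v. of_int (c i) * v $ i) = 0 \<longrightarrow> (\<forall>i<dim_vec v. c i = 0)) \<and>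
     I = {\<Sum>i<dim_vec v. of_int (c i) * v $ i | c :: nat \<Rightarrow> int. True}"

text \<open>A row eigenvector, \<open>v A = \<beta> v\<close>, is an eigenvector of the transpose of \<open>A\<close>. The ideal is
  only determined up to a nonzero factor from \<open>\<rat>(\<beta>)\<close>, so this is a relation.\<close>

definition associated_ideal :: "complex \<Rightarrow> int mat \<Rightarrow> complex set \<Rightarrow> bool" where
  "associated_ideal \<beta> A I \<longleftrightarrow> fractional_ideal \<beta> I \<and>
     (\<exists>v. eigenvector (transpose_mat (map_mat of_int A)) v \<beta> \<and>
          (\<forall>i<dim_vec v. v $ i \<in> Q_field \<beta>) \<and> Z_basis v I)"

definition coeff_ring :: "complex \<Rightarrow> complex set \<Rightarrow> complex set" where
  "coeff_ring \<beta> I = {z \<in> Q_field \<beta>. \<forall>x\<in>I. z * x \<in> I}"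

definition module_prod :: "complex set \<Rightarrow> complex set \<Rightarrow> complex set" where
  "module_prod X Y = group_closure {x * y | x y. x \<in> X \<and> y \<in> Y}"

text \<open>Here \<open>S\<close> is the common ring of coefficients of \<open>I\<close> and \<open>J\<close>.\<close>

definition weakly_equivalent :: "complex \<Rightarrow> complex set \<Rightarrow> complex set \<Rightarrow> complex set \<Rightarrow> bool" where
  "weakly_equivalent \<beta> S I J \<longleftrightarrow>
     (\<exists>X Y. fg_module S X \<and> X \<subseteq> Q_field \<beta> \<and> fg_module S Y \<and> Y \<subseteq> Q_field \<beta> \<and>
            module_prod I X = J \<and> module_prod J Y = I)"

definition poly_mat :: "int poly \<Rightarrow> int mat \<Rightarrow> int mat" where
  "poly_mat f A = mat (dim_row A) (dim_row A)
     (\<lambda>(i, j). \<Sum>k\<le>degree f. coeff f k * (A ^\<^sub>m k) $$ (i, j))"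

text \<open>The product \<open>m M\<close> of a row vector \<open>m\<close> and a matrix \<open>M\<close>.\<close>

definition row_mult :: "int vec \<Rightarrow> int mat \<Rightarrow> int vec" where
  "row_mult m M = transpose_mat M *\<^sub>v m"

definition Zx_mod :: "int poly \<Rightarrow> int poly set ring" where
  "Zx_mod p = class_ring Quot (PIdl\<^bsub>class_ring\<^esub> p)"

definition BF_sub :: "int poly \<Rightarrow> int mat \<Rightarrow> int vec set" where
  "BF_sub g A = {row_mult m (poly_mat g A) | m. m \<in> carrier_vec (dim_row A)}"

text \<open>The quotient of \<open>\<int>\<^sup>n\<close> by \<open>\<int>\<^sup>n g(A)\<close>, as a module over \<open>Zx_mod p\<close> with \<open>p\<close> the
  characteristic polynomial of \<open>A\<close>. Scalars and module elements are both cosets: the class of \<open>f\<close>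
  sends the class of \<open>m\<close> to the class of \<open>m f(A)\<close>, and by Cayley--Hamilton the union below is
  that one coset. The fields \<open>mult\<close> and \<open>one\<close> play no role for modules.\<close>

definition BF :: "int poly \<Rightarrow> int mat \<Rightarrow> (int poly set, int vec set) module" where
  "BF g A = (let V = module_vec TYPE(int) (dim_row A); H = BF_sub g A in
     \<lparr>carrier = a_rcosets\<^bsub>V\<^esub> H, monoid.mult = undefined, one = undefined,
      zero = H, add = set_add V,
      module.smult = (\<lambda>F M. \<Union>f\<in>F. \<Union>m\<in>M. H +>\<^bsub>V\<^esub> row_mult m (poly_mat f A))\<rparr>)"

definition module_isomorphic ::
  "('r, 'x) ring_scheme \<Rightarrow> ('r, 'm) module \<Rightarrow> ('r, 'n) module \<Rightarrow> bool" where
  "module_isomorphic R M N \<longleftrightarrow> (\<exists>h \<in> LinearCombinations.module_hom R M N. bij_betw h (carrier M) (carrier N))"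

text \<open>Meant for matrices with common characteristic polynomial \<open>p\<close>.\<close>

definition strongly_BF_equivalent :: "int poly \<Rightarrow> int mat \<Rightarrow> int mat \<Rightarrow> bool" where
  "strongly_BF_equivalent p A B \<longleftrightarrow>
     (\<forall>g. det (poly_mat g A) \<noteq> 0 \<longrightarrow> module_isomorphic (Zx_mod p) (BF g A) (BF g B))"

end

theory Submission
  imports Defs
begin

text \<open>
  Let \<open>a = g(\<beta>)\<close>. It is enough to find multipliers \<open>x\<close>, \<open>y\<close> with \<open>x I \<subseteq> J\<close> and \<open>y J \<subseteq> I\<close> that are
  inverse to each other modulo \<open>a\<close>, in the sense that \<open>(1 - x y) I \<subseteq> a I\<close> and \<open>(1 - x y) J \<subseteq> a J\<close>.
  Written in the \<open>\<int>\<close>-bases \<open>v\<close> of \<open>I\<close> and \<open>w\<close> of \<open>J\<close>, multiplication by \<open>y\<close> and by \<open>x\<close> gives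
  integer matrices with \<open>v P = y w\<close> and \<open>w Q = x v\<close>. Comparing actions on the eigenvectors, which
  determine an integer matrix, one reads off \<open>f(A) P = P f(B)\<close>, \<open>f(B) Q = Q f(A)\<close>,
  \<open>P Q = 1 + U g(A)\<close> and \<open>Q P = 1 + W g(B)\<close> with integer matrices \<open>U\<close>, \<open>W\<close>. So \<open>m \<mapsto> m P\<close> and
  \<open>m \<mapsto> m Q\<close> induce mutually inverse isomorphisms of the quotients of \<open>\<int>\<^sup>n\<close> by the row lattices
  of \<open>g(A)\<close> and \<open>g(B)\<close>. These quotients are dual to \<open>I / a I\<close> and \<open>J / a J\<close> rather than
  isomorphic to them (\<open>I\<close> is \<open>\<int>\<^sup>n\<close> with \<open>A\<close> acting on columns); working with matrices instead of
  modules makes the passage to the dual invisible, because a matrix acts on both sides.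

  The multipliers \<open>x \<in> X\<close> and \<open>y \<in> Y\<close> come from \<open>I X = J\<close> and \<open>J Y = I\<close>. Conceptually \<open>X\<close> is
  an invertible module over the ring \<open>S\<close> of coefficients, hence principal modulo \<open>a\<close>, since \<open>S / a S\<close>
  is finite and so semilocal. The proof below replaces maximal ideals by idempotents. As \<open>S / a S\<close>
  is finite, every element of \<open>S\<close> has a power that is idempotent modulo \<open>a\<close>; finiteness itself comes
  from \<open>a\<close> dividing the nonzero integer \<open>det g(A)\<close>. Let \<open>z\<^sub>1, \<dots>, z\<^sub>r\<close> be the products of
  generators of \<open>X\<close> and \<open>Y\<close>. Their idempotent powers can be glued one after the other into a single
  product \<open>e = x y\<close> that is idempotent modulo \<open>a\<close> and such that every \<open>(1 - e) z\<^sub>i\<close> is nilpotent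
  modulo \<open>a\<close> (\<open>idempotent_product_absorbing_powers\<close>). Since \<open>I = X Y I\<close>, an element \<open>c\<close> with
  \<open>c z\<^sub>i I \<subseteq> a I\<close> for all \<open>i\<close> satisfies \<open>c I \<subseteq> a I\<close>; applied repeatedly this turns the nilpotency
  into \<open>(1 - e) I \<subseteq> a I\<close> (\<open>mem_ideal_if_killed_by_powers\<close>).
\<close>

section \<open>Idempotents modulo an ideal\<close>

text \<open>In the application \<open>R\<close> is the ring of multipliers of a lattice \<open>I\<close> and \<open>K\<close> consists of the
  multipliers that carry \<open>I\<close> into \<open>a I\<close>. Congruence modulo \<open>K\<close> is written as membership of the
  difference in \<open>K\<close>.\<close>
locale subring_with_ideal =
  fixes R K :: "'a::comm_ring_1 set"
  assumes one_R: "1 \<in> R"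
    and diff_R: "x \<in> R \<Longrightarrow> y \<in> R \<Longrightarrow> x - y \<in> R"
    and mult_R: "x \<in> R \<Longrightarrow> y \<in> R \<Longrightarrow> x * y \<in> R"
    and zero_K: "0 \<in> K"
    and diff_K: "x \<in> K \<Longrightarrow> y \<in> K \<Longrightarrow> x - y \<in> K"
    and mult_K: "r \<in> R \<Longrightarrow> x \<in> K \<Longrightarrow> r * x \<in> K"
begin

lemma zero_R: "0 \<in> R"
  using diff_R[OF one_R one_R] by simp

lemma add_R: "x \<in> R \<Longrightarrow> y \<in> R \<Longrightarrow> x + y \<in> R"
  using diff_R[of x "0 - y"] diff_R[OF zero_R, of y] by simp

lemma power_R: "x \<in> R \<Longrightarrow> x ^ k \<in> R"
  by (induction k) (auto intro: one_R mult_R)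

lemma add_K: "x \<in> K \<Longrightarrow> y \<in> K \<Longrightarrow> x + y \<in> K"
  using diff_K[of x "0 - y"] diff_K[OF zero_K, of y] by simp

lemmas R_intros = one_R diff_R mult_R zero_R add_R power_R

definition submodule :: "'a set \<Rightarrow> bool" where
  "submodule X \<longleftrightarrow> 0 \<in> X \<and> (\<forall>x\<in>X. \<forall>y\<in>X. x + y \<in> X) \<and> (\<forall>r\<in>R. \<forall>x\<in>X. r * x \<in> X)"

lemma submoduleD:
  assumes "submodule X"
  shows "0 \<in> X" and "x \<in> X \<Longrightarrow> y \<in> X \<Longrightarrow> x + y \<in> X" and "r \<in> R \<Longrightarrow> x \<in> X \<Longrightarrow> r * x \<in> X"
  using assms by (auto simp: submodule_def)

lemma span_submodule:
  "submodule {\<Sum>g\<in>G. c g * g | c. \<forall>g\<in>G. c g \<in> R}"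
proof -
  let ?X = "{\<Sum>g\<in>G. c g * g | c. \<forall>g\<in>G. c g \<in> R}"
  have "0 \<in> ?X"
    using zero_R by (auto intro!: exI[of _ "\<lambda>_. 0"])
  moreover have "x + y \<in> ?X" if x: "x \<in> ?X" and y: "y \<in> ?X" for x y
  proof -
    obtain c e where "x = (\<Sum>g\<in>G. c g * g)" "y = (\<Sum>g\<in>G. e g * g)" "\<forall>g\<in>G. c g \<in> R" "\<forall>g\<in>G. e g \<in> R"
      using x y by blast
    then have "x + y = (\<Sum>g\<in>G. (c g + e g) * g)" "\<forall>g\<in>G. c g + e g \<in> R"
      by (simp_all add: sum.distrib distrib_right add_R)
    then show ?thesis
      by (intro CollectI exI[of _ "\<lambda>g. c g + e g"] conjI)
  qed
  moreover have "r * x \<in> ?X" if r: "r \<in> R" and x: "x \<in> ?X" for r x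
  proof -
    obtain c where "x = (\<Sum>g\<in>G. c g * g)" "\<forall>g\<in>G. c g \<in> R"
      using x by blast
    then have "r * x = (\<Sum>g\<in>G. (r * c g) * g)" "\<forall>g\<in>G. r * c g \<in> R"
      using r by (simp_all add: sum_distrib_left mult.assoc mult_R)
    then show ?thesis
      by (intro CollectI exI[of _ "\<lambda>g. r * c g"] conjI)
  qed
  ultimately show ?thesis
    by (auto simp: submodule_def)
qed

lemma span_superset:
  assumes "finite G"
  shows "G \<subseteq> {\<Sum>g\<in>G. c g * g | c. \<forall>g\<in>G. c g \<in> R}"
proof
  fix h assume "h \<in> G"
  then have "h = (\<Sum>g\<in>G. (if g = h then 1 else 0) * g)"
    using \<open>finite G\<close> by (simp add: if_distrib[of "\<lambda>c. c * _"] cong: if_cong)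
  then show "h \<in> {\<Sum>g\<in>G. c g * g | c. \<forall>g\<in>G. c g \<in> R}"
    using one_R zero_R by (intro CollectI exI[of _ "\<lambda>g. if g = h then 1 else 0"] conjI) simp_all
qed

text \<open>From \<open>z ^ i \<equiv> z ^ (i + d)\<close> the powers of \<open>z\<close> are \<open>d\<close>-periodic from \<open>i\<close> on, so the power with
  exponent \<open>i * d\<close>, a multiple of the period beyond \<open>i\<close>, equals its own square.\<close>

lemma idempotent_power_of_repeated_power:
  assumes z: "z \<in> R" and "i > 0" "d > 0" and rep: "z ^ (i + d) - z ^ i \<in> K"
  shows "\<exists>N>0. z ^ N * z ^ N - z ^ N \<in> K"
proof -
  have period: "z ^ (i + k * d) - z ^ i \<in> K" for k
  proof (induction k)
    case (Suc k)
    have "z ^ (i + Suc k * d) - z ^ i = z ^ d * (z ^ (i + k * d) - z ^ i) + (z ^ (i + d) - z ^ i)"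
      by (simp add: algebra_simps power_add)
    then show ?case
      using Suc rep z by (simp only: add_K mult_K power_R)
  qed (simp add: zero_K)
  have "z ^ (i * d) = z ^ (i * d - i) * z ^ i"
    using \<open>d > 0\<close> by (simp flip: power_add)
  then have "z ^ (i * d) * z ^ (i * d) - z ^ (i * d) = z ^ (i * d - i) * (z ^ (i + i * d) - z ^ i)"
    by (simp add: power_add right_diff_distrib mult.assoc)
  with period[of i] z have "z ^ (i * d) * z ^ (i * d) - z ^ (i * d) \<in> K"
    by (simp add: mult_K power_R)
  with \<open>i > 0\<close> \<open>d > 0\<close> show ?thesis
    by (intro exI[of _ "i * d"]) simp
qed

text \<open>Put \<open>e = x y\<close> and \<open>w = (x' y')\<^sup>N\<close>. The idempotents \<open>e\<close> and \<open>(1 - e) w\<close> are orthogonal modulo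
  \<open>K\<close>, so combining \<open>x\<close>, \<open>x'\<close> and \<open>y\<close>, \<open>y'\<close> with them as coefficients makes the mixed terms of
  the product vanish. The new product \<open>s t\<close> is congruent to \<open>f = e + (1 - e) w\<close>, whose
  complement factors as \<open>1 - f = (1 - e) (1 - w)\<close>. The second factor kills \<open>w\<close>, and the first one
  preserves everything that \<open>1 - e\<close> killed before.\<close>
lemma glue_idempotent_products:
  assumes X: "submodule X" and Y: "submodule Y"
    and XY: "\<And>x y. x \<in> X \<Longrightarrow> y \<in> Y \<Longrightarrow> x * y \<in> R"
    and x: "x \<in> X" and y: "y \<in> Y" and idem: "(x * y) * (x * y) - x * y \<in> K"
    and x': "x' \<in> X" and y': "y' \<in> Y"
    and "N > 0" and idem': "(x' * y') ^ N * (x' * y') ^ N - (x' * y') ^ N \<in> K"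
  obtains s t where "s \<in> X" "t \<in> Y" "(s * t) * (s * t) - s * t \<in> K"
    and "(1 - s * t) * (x' * y') ^ N \<in> K"
    and "\<And>r. r \<in> R \<Longrightarrow> (1 - x * y) * r \<in> K \<Longrightarrow> (1 - s * t) * r \<in> K"
proof -
  define e where "e = x * y"
  define z where "z = x' * y'"
  define w where "w = z ^ N"
  define s where "s = e * x + (1 - e) * w * x'"
  define t where "t = e * y + (1 - e) * z ^ (N - 1) * y'"
  define f where "f = e + (1 - e) * w"
  define k where "k = e * e - e"
  define l where "l = w * w - w"
  have R: "e \<in> R" "z \<in> R" "w \<in> R" "x * y' \<in> R" "x' * y \<in> R"
    using x y x' y' by (auto simp: e_def z_def w_def intro!: XY power_R)
  have K: "k \<in> K" "l \<in> K"
    using idem idem' by (auto simp: k_def l_def e_def w_def z_def)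
  have s: "s \<in> X" and t: "t \<in> Y"
    unfolding s_def t_def using X Y x y x' y' R by (auto intro!: submoduleD R_intros)
  \<comment> \<open>The exponent \<open>N - 1\<close> in \<open>t\<close> leaves room for the factor \<open>z\<close> that \<open>x' y'\<close> contributes to \<open>s t\<close>.\<close>
  have w_eq: "z ^ (N - 1) * z = w"
    using \<open>N > 0\<close> by (simp add: w_def power_eq_if mult.commute)
  have "s * t = e * e * (x * y) + (1 - e) * (1 - e) * w * (z ^ (N - 1) * (x' * y'))
      + e * (1 - e) * (z ^ (N - 1) * (x * y') + w * (x' * y))"
    unfolding s_def t_def by (simp add: algebra_simps)
  also have "\<dots> = e * e * e + (1 - e) * (1 - e) * w * w
      + e * (1 - e) * (z ^ (N - 1) * (x * y') + w * (x' * y))"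
    by (simp only: e_def[symmetric] z_def[symmetric] w_eq)
  finally have st: "s * t - f = (e + 1) * k + ((1 - e) * l + w * w * k)
      - (z ^ (N - 1) * (x * y') + w * (x' * y)) * k"
    by (simp add: f_def k_def l_def algebra_simps)
  have near: "s * t - f \<in> K"
    unfolding st using K R by - (assumption | rule diff_K add_K mult_K R_intros)+
  have stR: "s * t \<in> R" and fR: "f \<in> R"
    using XY s t R by (auto simp: f_def intro!: R_intros)
  have "(s * t) * (s * t) - s * t = (s * t + f - 1) * (s * t - f) + (f * f - f)"
    by (simp add: algebra_simps)
  also have "f * f - f = (1 - w) * (1 - w) * k + (1 - e) * l"
    by (simp add: f_def k_def l_def algebra_simps)
  finally have 1: "(s * t) * (s * t) - s * t \<in> K"
    using near K R stR fR by (auto intro!: add_K mult_K R_intros)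
  have split: "(1 - s * t) * r = (1 - w) * ((1 - e) * r) - r * (s * t - f)" for r
    by (simp add: f_def algebra_simps)
  have 2: "(1 - s * t) * r \<in> K" if "r \<in> R" "(1 - e) * r \<in> K" for r
    unfolding split using that near R by - (assumption | rule diff_K mult_K R_intros)+
  have "(1 - s * t) * w = (0 - (1 - e)) * l - w * (s * t - f)"
    by (simp add: f_def l_def algebra_simps)
  then have 3: "(1 - s * t) * w \<in> K"
    using near R K by (simp only:) (assumption | rule diff_K mult_K R_intros)+
  show ?thesis
    using that[OF s t 1] 2 3 by (simp add: e_def w_def z_def)
qed

text \<open>Starting from \<open>e = 0\<close>, the pairs are glued on one after the other; the complement \<open>1 - e\<close>
  goes on killing the powers that it killed before.\<close>
lemma idempotent_product_absorbing_powers: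
  assumes X: "submodule X" and Y: "submodule Y"
    and XY: "\<And>x y. x \<in> X \<Longrightarrow> y \<in> Y \<Longrightarrow> x * y \<in> R"
    and idem: "\<And>z. z \<in> R \<Longrightarrow> \<exists>N>0. z ^ N * z ^ N - z ^ N \<in> K"
    and "finite T" and "T \<subseteq> X \<times> Y"
  shows "\<exists>x\<in>X. \<exists>y\<in>Y. (x * y) * (x * y) - x * y \<in> K \<and>
    (\<forall>(x', y')\<in>T. \<exists>M. (1 - x * y) * (x' * y') ^ M \<in> K)"
  using \<open>finite T\<close> \<open>T \<subseteq> X \<times> Y\<close>
proof (induction T rule: finite_induct)
  case empty
  show ?case
    by (intro bexI[of _ 0]) (simp_all add: submoduleD(1)[OF X] submoduleD(1)[OF Y] zero_K)
next
  case (insert p T)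
  obtain x' y' where p: "p = (x', y')" and xy': "x' \<in> X" "y' \<in> Y"
    using insert.prems by auto
  obtain x y where xy: "x \<in> X" "y \<in> Y" "(x * y) * (x * y) - x * y \<in> K"
    and T: "\<forall>(x', y')\<in>T. \<exists>M. (1 - x * y) * (x' * y') ^ M \<in> K"
    using insert.IH insert.prems by blast
  obtain N where N: "N > 0" "(x' * y') ^ N * (x' * y') ^ N - (x' * y') ^ N \<in> K"
    using idem[OF XY[OF xy']] by blast
  obtain s t where st: "s \<in> X" "t \<in> Y" "(s * t) * (s * t) - s * t \<in> K"
      "(1 - s * t) * (x' * y') ^ N \<in> K"
    and keep: "\<And>r. r \<in> R \<Longrightarrow> (1 - x * y) * r \<in> K \<Longrightarrow> (1 - s * t) * r \<in> K"
    by (rule glue_idempotent_products[OF X Y _ xy xy' N]) (simp_all add: XY)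
  have old: "\<exists>M. (1 - s * t) * (u * v) ^ M \<in> K" if "(u, v) \<in> T" for u v
  proof -
    obtain M where "(1 - x * y) * (u * v) ^ M \<in> K"
      using T \<open>(u, v) \<in> T\<close> by blast
    moreover have "(u * v) ^ M \<in> R"
      using insert.prems \<open>(u, v) \<in> T\<close> by (intro power_R XY) auto
    ultimately show ?thesis
      using keep by blast
  qed
  have "\<forall>(u, v)\<in>insert p T. \<exists>M. (1 - s * t) * (u * v) ^ M \<in> K"
  proof (rule ballI, clarify)
    fix u v assume "(u, v) \<in> insert p T"
    then consider "u = x'" "v = y'" | "(u, v) \<in> T"
      unfolding p by blast
    then show "\<exists>M. (1 - s * t) * (u * v) ^ M \<in> K"
      using st(4) old by cases blast+
  qed
  with st(1-3) show ?case
    by blast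
qed

text \<open>The set \<open>T\<close> behaves like generators of the unit ideal: whatever is multiplied into \<open>K\<close> by all of
  \<open>T\<close> lies in \<open>K\<close>. Passing from \<open>c\<close> to \<open>c z\<close> lowers the exponent that belongs to \<open>z\<close>, so induction
  on the sum of the exponents applies to all \<open>c z\<close>, and \<open>c\<close> itself follows.\<close>
lemma mem_ideal_if_killed_by_powers:
  assumes "finite T" and "T \<subseteq> R"
    and detect: "\<And>c. c \<in> R \<Longrightarrow> (\<And>z. z \<in> T \<Longrightarrow> c * z \<in> K) \<Longrightarrow> c \<in> K"
    and "c \<in> R" and "\<And>z. z \<in> T \<Longrightarrow> \<exists>M. c * z ^ M \<in> K"
  shows "c \<in> K"
proof -
  have bounded: "c \<in> K" if "c \<in> R" "\<And>z. z \<in> T \<Longrightarrow> c * z ^ M z \<in> K" for M :: "'a \<Rightarrow> nat" and c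
    using that
  proof (induction "\<Sum>z\<in>T. M z" arbitrary: M c rule: less_induct)
    case less
    show ?case
    proof (rule detect[OF less.prems(1)])
      fix z assume z: "z \<in> T"
      show "c * z \<in> K"
      proof (cases "M z")
        case 0
        then show ?thesis
          using less.prems(2)[OF z] z \<open>T \<subseteq> R\<close> mult_K[of z c] by (auto simp: mult.commute)
      next
        case (Suc m)
        have smaller: "(\<Sum>u\<in>T. (M(z := m)) u) < (\<Sum>u\<in>T. M u)"
          using z Suc \<open>finite T\<close> by (intro sum_strict_mono_ex1) auto
        have "(c * z) * u ^ (M(z := m)) u \<in> K" if "u \<in> T" for u
        proof (cases "u = z")
          case True
          then show ?thesis
            using less.prems(2)[OF z] Suc by (simp add: mult.assoc)
        next
          case False
          have "z * (c * u ^ M u) \<in> K"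
            using less.prems(2)[OF that] z \<open>T \<subseteq> R\<close> by (blast intro: mult_K)
          then show ?thesis
            using False by (simp add: mult_ac)
        qed
        then show ?thesis
          using less.hyps[OF smaller] less.prems(1) z \<open>T \<subseteq> R\<close> by (auto intro: mult_R)
      qed
    qed
  qed
  obtain M where "\<And>z. z \<in> T \<Longrightarrow> c * z ^ M z \<in> K"
    using assms(5) by metis
  with bounded \<open>c \<in> R\<close> show "c \<in> K"
    by blast
qed

text \<open>The last hypothesis expresses that the products \<open>g h\<close> generate the unit ideal modulo \<open>K\<close>, without
  naming coefficients. It stands in for invertibility of \<open>X\<close> with inverse \<open>Y\<close>.\<close>
lemma product_congruent_to_one:
  assumes X: "submodule X" and Y: "submodule Y"
    and XY: "\<And>x y. x \<in> X \<Longrightarrow> y \<in> Y \<Longrightarrow> x * y \<in> R"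
    and idem: "\<And>z. z \<in> R \<Longrightarrow> \<exists>N>0. z ^ N * z ^ N - z ^ N \<in> K"
    and GH: "finite G" "G \<subseteq> X" "finite H" "H \<subseteq> Y"
    and detect: "\<And>c. c \<in> R \<Longrightarrow> (\<And>g h. g \<in> G \<Longrightarrow> h \<in> H \<Longrightarrow> c * (g * h) \<in> K) \<Longrightarrow> c \<in> K"
  obtains x y where "x \<in> X" "y \<in> Y" "1 - x * y \<in> K"
proof -
  have "finite (G \<times> H)" "G \<times> H \<subseteq> X \<times> Y"
    using GH by auto
  then have "\<exists>x\<in>X. \<exists>y\<in>Y. (x * y) * (x * y) - x * y \<in> K \<and>
      (\<forall>(g, h)\<in>G \<times> H. \<exists>M. (1 - x * y) * (g * h) ^ M \<in> K)"
    by (intro idempotent_product_absorbing_powers X Y XY idem)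
  then obtain x y where xy: "x \<in> X" "y \<in> Y"
    and pow: "\<And>g h. (g, h) \<in> G \<times> H \<Longrightarrow> \<exists>M. (1 - x * y) * (g * h) ^ M \<in> K"
    by blast
  define T where "T = (\<lambda>(g, h). g * h) ` (G \<times> H)"
  have prod_T: "g * h \<in> T" if "g \<in> G" "h \<in> H" for g h
    unfolding T_def using that by (intro image_eqI[of _ _ "(g, h)"]) auto
  have T_cases: "\<exists>g\<in>G. \<exists>h\<in>H. z = g * h" if "z \<in> T" for z
    using that unfolding T_def by auto
  have "1 - x * y \<in> K"
  proof (rule mem_ideal_if_killed_by_powers[of T])
    show "finite T"
      unfolding T_def using GH by auto
    show "T \<subseteq> R"
      using T_cases GH XY by blast
    show "1 - x * y \<in> R"
      by (intro diff_R one_R XY xy)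
  next
    fix c assume "c \<in> R" and c: "\<And>z. z \<in> T \<Longrightarrow> c * z \<in> K"
    from \<open>c \<in> R\<close> show "c \<in> K"
      by (rule detect) (rule c[OF prod_T])
  next
    fix z assume "z \<in> T"
    then obtain g h where gh: "g \<in> G" "h \<in> H" "z = g * h"
      using T_cases by blast
    show "\<exists>M. (1 - x * y) * z ^ M \<in> K"
      unfolding gh(3) using gh(1,2) by (intro pow SigmaI)
  qed
  with xy show ?thesis
    using that by blast
qed

end

section \<open>Integer matrices acting on row vectors\<close>

definition row_act :: "complex vec \<Rightarrow> int mat \<Rightarrow> complex vec" where
  "row_act v M = transpose_mat (map_mat of_int M) *\<^sub>v v"

lemma row_act_carrier: "M \<in> carrier_mat n m \<Longrightarrow> row_act v M \<in> carrier_vec m"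
  by (simp add: row_act_def carrier_vecI)

lemma dim_row_act [simp]: "dim_vec (row_act v M) = dim_col M"
  by (simp add: row_act_def)

lemma row_act_index:
  assumes "M \<in> carrier_mat n m" "v \<in> carrier_vec n" "j < m"
  shows "row_act v M $ j = (\<Sum>i<n. of_int (M $$ (i, j)) * v $ i)"
  using assms by (auto simp: row_act_def scalar_prod_def lessThan_atLeast0 intro!: sum.cong)

lemma row_act_mult:
  assumes "v \<in> carrier_vec n" "M \<in> carrier_mat n m" "N \<in> carrier_mat m k"
  shows "row_act v (M * N) = row_act (row_act v M) N"
proof -
  have "row_act v (M * N) = transpose_mat (map_mat of_int M * map_mat of_int N) *\<^sub>v v"
    using assms by (simp add: row_act_def of_int_hom.mat_hom_mult)
  also have "\<dots> = (transpose_mat (map_mat of_int N) * transpose_mat (map_mat of_int M)) *\<^sub>v v"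
    using assms by (subst transpose_mult[of _ n m _ k]) auto
  also have "\<dots> = row_act (row_act v M) N"
    using assms unfolding row_act_def by (intro assoc_mult_mat_vec[of _ k m _ n]) auto
  finally show ?thesis .
qed

lemma row_act_scale:
  assumes "v \<in> carrier_vec n" "M \<in> carrier_mat n m"
  shows "row_act (c \<cdot>\<^sub>v v) M = c \<cdot>\<^sub>v row_act v M"
  using assms unfolding row_act_def by (intro mult_mat_vec[of _ m n]) auto

lemma row_act_one: "v \<in> carrier_vec n \<Longrightarrow> row_act v (1\<^sub>m n) = v"
  by (simp add: row_act_def of_int_hom.mat_hom_one)

lemma row_act_add:
  assumes "v \<in> carrier_vec n" "M \<in> carrier_mat n m" "N \<in> carrier_mat n m"
  shows "row_act v (M + N) = row_act v M + row_act v N"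
  by (rule eq_vecI) (use assms in \<open>auto simp: row_act_index[of _ n m] sum.distrib distrib_right\<close>)

lemma row_act_minus:
  assumes "v \<in> carrier_vec n" "M \<in> carrier_mat n m" "N \<in> carrier_mat n m"
  shows "row_act v (M - N) = row_act v M - row_act v N"
  by (rule eq_vecI) (use assms minus_carrier_mat[OF assms(3), of M] in
    \<open>auto simp: row_act_index[of _ n m] sum_subtractf left_diff_distrib\<close>)

lemma row_act_int_smult:
  assumes "v \<in> carrier_vec n" "M \<in> carrier_mat n m"
  shows "row_act v (d \<cdot>\<^sub>m M) = of_int d \<cdot>\<^sub>v row_act v M"
  by (rule eq_vecI) (use assms in \<open>auto simp: row_act_index[of _ n m] sum_distrib_left mult.assoc\<close>)

text \<open>The entries of \<open>v\<close> are independent over \<open>\<int>\<close>, so identities between integer matrices can be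
  checked on the single vector \<open>v\<close>.\<close>
lemma Z_basis_row_act_inject:
  assumes v: "Z_basis v I" "v \<in> carrier_vec n"
    and M: "M \<in> carrier_mat n m" and N: "N \<in> carrier_mat n m"
    and eq: "row_act v M = row_act v N"
  shows "M = N"
proof (rule eq_matI)
  fix i j assume "i < dim_row N" "j < dim_col N"
  with N have ij: "i < n" "j < m"
    by auto
  have "(\<Sum>i<n. of_int ((M - N) $$ (i, j)) * v $ i) = (row_act v M - row_act v N) $ j"
    using v M N ij minus_carrier_mat[OF N, of M]
    by (simp add: row_act_minus[symmetric, of v n _ m] row_act_index[of _ n m])
  also have "\<dots> = 0"
    using ij eq N by simp
  finally have "\<forall>i<n. (M - N) $$ (i, j) = 0"
    using v by (auto simp: Z_basis_def)
  then show "M $$ (i, j) = N $$ (i, j)"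
    using M N ij by auto
qed (use M N in auto)

lemma Z_basis_obtain_matrix:
  assumes v: "Z_basis v I" "v \<in> carrier_vec n"
    and u: "u \<in> carrier_vec m" "\<And>j. j < m \<Longrightarrow> u $ j \<in> I"
  obtains M where "M \<in> carrier_mat n m" "row_act v M = u"
proof -
  have "\<exists>c :: nat \<Rightarrow> int. u $ j = (\<Sum>i<n. of_int (c i) * v $ i)" if "j < m" for j
    using u(2)[OF that] v by (auto simp: Z_basis_def)
  then obtain c :: "nat \<Rightarrow> nat \<Rightarrow> int"
    where c: "\<And>j. j < m \<Longrightarrow> u $ j = (\<Sum>i<n. of_int (c j i) * v $ i)"
    by metis
  let ?M = "mat n m (\<lambda>(i, j). c j i)"
  have "row_act v ?M = u"
    using u(1) v(2) by (intro eq_vecI) (auto simp: row_act_index[of _ n m] c)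
  then show ?thesis
    by (intro that[of ?M]) auto
qed

lemma Z_basis_row_act_mem:
  assumes "Z_basis v I" "v \<in> carrier_vec n" "M \<in> carrier_mat n m" "j < m"
  shows "row_act v M $ j \<in> I"
  using assms by (auto simp: Z_basis_def row_act_index[of _ n m])

lemma Z_basis_vec_mem:
  assumes "Z_basis v I" "v \<in> carrier_vec n" "i < n"
  shows "v $ i \<in> I"
  using Z_basis_row_act_mem[of v I n "1\<^sub>m n" n i] assms by (simp add: row_act_one)

lemma poly_mat_carrier: "A \<in> carrier_mat n n \<Longrightarrow> poly_mat f A \<in> carrier_mat n n"
  by (auto simp: poly_mat_def)

lemma row_act_poly_mat:
  assumes A: "A \<in> carrier_mat n n" and v: "v \<in> carrier_vec n"
    and eig: "row_act v A = \<beta> \<cdot>\<^sub>v v"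
  shows "row_act v (poly_mat f A) = poly (map_poly of_int f) \<beta> \<cdot>\<^sub>v v"
proof -
  have pow: "row_act v (A ^\<^sub>m k) = \<beta> ^ k \<cdot>\<^sub>v v" for k
  proof (induction k)
    case (Suc k)
    have "row_act v (A ^\<^sub>m Suc k) = row_act (\<beta> ^ k \<cdot>\<^sub>v v) A"
      using A v Suc by (simp add: row_act_mult[of v n _ n _ n])
    then show ?case
      using A v eig by (simp add: row_act_scale[of v n A n] smult_smult_assoc mult_ac)
  qed (use A v in \<open>simp add: row_act_one\<close>)
  show ?thesis
  proof (rule eq_vecI)
    fix j assume "j < dim_vec (poly (map_poly of_int f) \<beta> \<cdot>\<^sub>v v)"
    with v have j: "j < n"
      by simp
    have "row_act v (poly_mat f A) $ j
        = (\<Sum>i<n. \<Sum>k\<le>degree f. of_int (coeff f k) * (of_int ((A ^\<^sub>m k) $$ (i, j)) * v $ i))"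
      unfolding row_act_index[OF poly_mat_carrier[OF A] v j] using A j
      by (intro sum.cong) (auto simp: poly_mat_def sum_distrib_left sum_distrib_right mult_ac)
    also have "\<dots> = (\<Sum>k\<le>degree f. of_int (coeff f k) * (row_act v (A ^\<^sub>m k) $ j))"
      using A v j by (subst sum.swap) (simp add: row_act_index[of _ n n] sum_distrib_left)
    also have "\<dots> = (\<Sum>k\<le>degree f. of_int (coeff f k) * \<beta> ^ k) * v $ j"
      using v j by (simp add: pow sum_distrib_right mult.assoc)
    also have "(\<Sum>k\<le>degree f. of_int (coeff f k) * \<beta> ^ k) = poly (map_poly of_int f) \<beta>"
      by (simp add: poly_altdef)
    finally show "row_act v (poly_mat f A) $ j = (poly (map_poly of_int f) \<beta> \<cdot>\<^sub>v v) $ j"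
      using v j by simp
  qed (use v carrier_matD[OF poly_mat_carrier[OF A]] in simp)
qed

text \<open>There are only finitely many matrices modulo \<open>d\<close>. This is the finiteness of \<open>S / a S\<close> in the form
  in which it is needed.\<close>
lemma matrices_congruent_pigeonhole:
  fixes M :: "nat \<Rightarrow> int mat"
  assumes "d \<noteq> 0" and M: "\<And>k. M k \<in> carrier_mat n m"
  obtains i j U where "i < j" "U \<in> carrier_mat n m" "M j - M i = d \<cdot>\<^sub>m U"
proof -
  define r where "r k = restrict (\<lambda>p. M k $$ p mod \<bar>d\<bar>) ({..<n} \<times> {..<m})" for k
  have "range r \<subseteq> ({..<n} \<times> {..<m}) \<rightarrow>\<^sub>E {0..<\<bar>d\<bar>}"
    using \<open>d \<noteq> 0\<close> unfolding r_def by (intro image_subsetI restrict_PiE_iff[THEN iffD2]) auto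
  moreover have "finite (({..<n} \<times> {..<m}) \<rightarrow>\<^sub>E {0..<\<bar>d\<bar>})"
    by (intro finite_PiE) auto
  ultimately have "\<not> inj r"
    using finite_subset range_inj_infinite by blast
  then obtain i j where "i < j" "r i = r j"
    by (metis injI linorder_neqE_nat)
  have dvd: "d dvd M j $$ p - M i $$ p" if "p \<in> {..<n} \<times> {..<m}" for p
  proof -
    have "M j $$ p mod \<bar>d\<bar> = M i $$ p mod \<bar>d\<bar>"
      using fun_cong[OF \<open>r i = r j\<close>, of p] that by (simp only: r_def restrict_apply if_True)
    then show ?thesis
      by (simp add: mod_eq_dvd_iff)
  qed
  let ?U = "map_mat (\<lambda>x. x div d) (M j - M i)"
  have "M j - M i = d \<cdot>\<^sub>m ?U"
    using M dvd by (intro eq_matI) (auto simp: carrier_matD[OF M])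
  moreover have "?U \<in> carrier_mat n m"
    using M minus_carrier_mat[of "M i" n m "M j"] by simp
  ultimately show ?thesis
    using \<open>i < j\<close> by (intro that)
qed

section \<open>Lattices and their multipliers\<close>

definition additive_group :: "complex set \<Rightarrow> bool" where
  "additive_group L \<longleftrightarrow> 0 \<in> L \<and> (\<forall>x\<in>L. \<forall>y\<in>L. x - y \<in> L)"

lemma additive_groupD:
  assumes "additive_group L"
  shows "0 \<in> L" "x \<in> L \<Longrightarrow> y \<in> L \<Longrightarrow> x - y \<in> L" "x \<in> L \<Longrightarrow> y \<in> L \<Longrightarrow> x + y \<in> L"
proof -
  show 1: "0 \<in> L" "x \<in> L \<Longrightarrow> y \<in> L \<Longrightarrow> x - y \<in> L" for x y
    using assms by (auto simp: additive_group_def)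
  show "x \<in> L \<Longrightarrow> y \<in> L \<Longrightarrow> x + y \<in> L"
    using 1(2)[of x "0 - y"] 1(2)[of 0 y] 1(1) by simp
qed

lemma additive_group_sum:
  assumes "additive_group L" "\<And>i. i \<in> A \<Longrightarrow> f i \<in> L"
  shows "sum f A \<in> L"
  using assms(2) by (induction A rule: infinite_finite_induct)
    (auto intro: additive_groupD[OF assms(1)])

lemma additive_group_of_int_mult:
  assumes L: "additive_group L" "x \<in> L"
  shows "of_int k * x \<in> L"
proof (induction k rule: int_induct[where k = 0])
  case (step1 i)
  then show ?case
    using additive_groupD(3)[OF L(1) _ L(2)] by (simp add: distrib_right)
next
  case (step2 i)
  then show ?case
    using additive_groupD(2)[OF L(1) _ L(2)] by (simp add: left_diff_distrib)
qed (use L in \<open>auto simp: additive_groupD\<close>)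

lemma additive_group_scale: "additive_group L \<Longrightarrow> additive_group {a * x | x. x \<in> L}"
  by (force simp: additive_group_def right_diff_distrib[symmetric])

lemma additive_group_group_closure: "additive_group (group_closure S)"
  by (auto simp: additive_group_def intro: group_closure.diff)

text \<open>A containment \<open>c I \<subseteq> L\<close> in an additive group \<open>L\<close> need only be tested on additive generators.\<close>
lemma group_closure_mult_mem:
  assumes L: "additive_group L" and "\<And>s. s \<in> S \<Longrightarrow> c * s \<in> L" and "x \<in> group_closure S"
  shows "c * x \<in> L"
  using assms(3)
proof (induction rule: group_closure.induct)
  case (base s)
  then show ?case
    using assms(2) additive_groupD(1)[OF L] by auto
next
  case (diff s t)
  then show ?case
    using additive_groupD(2)[OF L] by (simp add: right_diff_distrib)
qed

lemma Z_basis_additive_group: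
  assumes "Z_basis v I"
  shows "additive_group I"
proof -
  have I: "I = {\<Sum>i<dim_vec v. of_int (c i) * v $ i | c :: nat \<Rightarrow> int. True}"
    using assms by (simp add: Z_basis_def)
  have "0 \<in> I"
    unfolding I by (intro CollectI exI[of _ "\<lambda>_. 0"]) simp
  moreover have "x - y \<in> I" if "x \<in> I" "y \<in> I" for x y
  proof -
    obtain b c :: "nat \<Rightarrow> int" where "x = (\<Sum>i<dim_vec v. of_int (b i) * v $ i)"
      "y = (\<Sum>i<dim_vec v. of_int (c i) * v $ i)"
      using \<open>x \<in> I\<close> \<open>y \<in> I\<close> unfolding I by blast
    then have "x - y = (\<Sum>i<dim_vec v. of_int (b i - c i) * v $ i)"
      by (simp add: sum_subtractf left_diff_distrib)
    then show ?thesis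
      unfolding I by (intro CollectI exI[of _ "\<lambda>i. b i - c i"] conjI TrueI)
  qed
  ultimately show ?thesis
    by (simp add: additive_group_def)
qed

lemma Z_basis_mult_mem:
  assumes v: "Z_basis v I" "v \<in> carrier_vec n" and L: "additive_group L"
    and "\<And>i. i < n \<Longrightarrow> c * v $ i \<in> L" and "x \<in> I"
  shows "c * x \<in> L"
proof -
  obtain b :: "nat \<Rightarrow> int" where x: "x = (\<Sum>i<n. of_int (b i) * v $ i)"
    using v \<open>x \<in> I\<close> by (auto simp: Z_basis_def)
  have "c * x = (\<Sum>i<n. of_int (b i) * (c * v $ i))"
    by (simp add: x sum_distrib_left mult_ac)
  then show ?thesis
    using assms(4) by (auto intro: additive_group_sum[OF L] additive_group_of_int_mult[OF L])
qed

lemma Q_field_divide: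
  assumes "x \<in> Q_field \<beta>" "y \<in> Q_field \<beta>" "y \<noteq> 0"
  shows "x / y \<in> Q_field \<beta>"
proof -
  interpret of_rat_hom: map_poly_comm_ring_hom "of_rat :: rat \<Rightarrow> complex"
    by unfold_locales (simp_all add: of_rat_mult of_rat_add)
  obtain f g h k where x: "x = poly (map_poly of_rat f) \<beta> / poly (map_poly of_rat g) \<beta>"
      "poly (map_poly of_rat g) \<beta> \<noteq> 0"
    and y: "y = poly (map_poly of_rat h) \<beta> / poly (map_poly of_rat k) \<beta>"
      "poly (map_poly of_rat k) \<beta> \<noteq> 0"
    using assms by (auto simp: Q_field_def)
  have "x / y = poly (map_poly of_rat (f * k)) \<beta> / poly (map_poly of_rat (g * h)) \<beta>"
    "poly (map_poly of_rat (g * h)) \<beta> \<noteq> 0"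
    using x y \<open>y \<noteq> 0\<close> by (simp_all add: of_rat_hom.hom_mult)
  then show ?thesis
    unfolding Q_field_def by blast
qed

definition mult_into :: "complex set \<Rightarrow> complex set \<Rightarrow> complex set" where
  "mult_into I L = {z. \<forall>x\<in>I. z * x \<in> L}"

lemma mult_intoI: "(\<And>x. x \<in> I \<Longrightarrow> z * x \<in> L) \<Longrightarrow> z \<in> mult_into I L"
  by (simp add: mult_into_def)

lemma mult_intoD: "z \<in> mult_into I L \<Longrightarrow> x \<in> I \<Longrightarrow> z * x \<in> L"
  by (simp add: mult_into_def)

text \<open>A multiplier \<open>z\<close> is the quotient of \<open>z x\<close> by \<open>x\<close>, both elements of \<open>I\<close>, so it lies in \<open>\<rat>(\<beta>)\<close> by
  itself.\<close>
lemma coeff_ring_eq_mult_into: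
  assumes "I \<subseteq> Q_field \<beta>" and "x \<in> I" "x \<noteq> 0"
  shows "coeff_ring \<beta> I = mult_into I I"
proof -
  have "z \<in> Q_field \<beta>" if "z \<in> mult_into I I" for z
    using Q_field_divide[of "z * x" \<beta> x] mult_intoD[OF that \<open>x \<in> I\<close>] assms by auto
  then show ?thesis
    by (auto simp: coeff_ring_def mult_into_def)
qed

lemma subring_with_ideal_multipliers:
  assumes I: "additive_group I"
  shows "subring_with_ideal (mult_into I I) (mult_into I {a * x | x. x \<in> I})"
proof -
  note L = additive_group_scale[OF I, of a]
  show ?thesis
  proof
    show "x - y \<in> mult_into I I" if "x \<in> mult_into I I" "y \<in> mult_into I I" for x y
      using that by (auto simp: mult_into_def left_diff_distrib intro: additive_groupD[OF I])
    show "x - y \<in> mult_into I {a * x | x. x \<in> I}"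
      if "x \<in> mult_into I {a * x | x. x \<in> I}" "y \<in> mult_into I {a * x | x. x \<in> I}" for x y
      using that additive_groupD(2)[OF L] by (simp add: mult_into_def left_diff_distrib)
    show "0 \<in> mult_into I {a * x | x. x \<in> I}"
      using additive_groupD(1)[OF L] by (simp add: mult_into_def)
    show "r * x \<in> mult_into I {a * x | x. x \<in> I}"
      if r: "r \<in> mult_into I I" and x: "x \<in> mult_into I {a * x | x. x \<in> I}" for r x
    proof (rule mult_intoI)
      fix u assume "u \<in> I"
      then obtain u' where "u' \<in> I" "x * u = a * u'"
        using mult_intoD[OF x] by blast
      then have "(r * x) * u = a * (r * u')" "r * u' \<in> I"
        using mult_intoD[OF r] by (simp_all add: mult.assoc mult.left_commute)
      then show "(r * x) * u \<in> {a * x | x. x \<in> I}"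
        by blast
    qed
  qed (auto simp: mult_into_def mult.assoc)
qed

text \<open>In the basis \<open>v\<close> the powers of \<open>z\<close> become integer matrices, and two of them agree modulo \<open>d\<close>. As
  \<open>d I \<subseteq> a I\<close>, the corresponding powers of \<open>z\<close> agree modulo the multipliers into \<open>a I\<close>.\<close>
lemma idempotent_power_multiplier:
  assumes v: "Z_basis v I" "v \<in> carrier_vec n" and I: "additive_group I"
    and "d \<noteq> 0" and d: "\<And>x. x \<in> I \<Longrightarrow> of_int d * x \<in> {a * x | x. x \<in> I}"
    and z: "z \<in> mult_into I I"
  shows "\<exists>N>0. z ^ N * z ^ N - z ^ N \<in> mult_into I {a * x | x. x \<in> I}"
proof -
  interpret subring_with_ideal "mult_into I I" "mult_into I {a * x | x. x \<in> I}"
    by (rule subring_with_ideal_multipliers[OF I])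
  have "\<forall>k. \<exists>M. M \<in> carrier_mat n n \<and> row_act v M = z ^ Suc k \<cdot>\<^sub>v v"
  proof
    fix k
    have "(z ^ Suc k \<cdot>\<^sub>v v) $ i \<in> I" if "i < n" for i
      using mult_intoD[OF power_R[OF z, of "Suc k"] Z_basis_vec_mem[OF v that]] v that by simp
    with v(2) obtain M where "M \<in> carrier_mat n n" "row_act v M = z ^ Suc k \<cdot>\<^sub>v v"
      by (rule_tac Z_basis_obtain_matrix[OF v, of "z ^ Suc k \<cdot>\<^sub>v v" n]) simp_all
    then show "\<exists>M. M \<in> carrier_mat n n \<and> row_act v M = z ^ Suc k \<cdot>\<^sub>v v"
      by blast
  qed
  from choice[OF this] obtain M where M: "M k \<in> carrier_mat n n"
    and zM: "row_act v (M k) = z ^ Suc k \<cdot>\<^sub>v v" for k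
    by blast
  obtain i j U where ij: "i < j" and U: "U \<in> carrier_mat n n" "M j - M i = d \<cdot>\<^sub>m U"
    by (rule matrices_congruent_pigeonhole[OF \<open>d \<noteq> 0\<close> M])
  have "(z ^ Suc j - z ^ Suc i) * v $ l \<in> {a * x | x. x \<in> I}" if "l < n" for l
  proof -
    have "(z ^ Suc j - z ^ Suc i) * v $ l = row_act v (M j - M i) $ l"
      using v(2) that M by (simp add: row_act_minus[of v n _ n] zM left_diff_distrib)
    also have "\<dots> = of_int d * row_act v U $ l"
      using v(2) U that by (simp add: row_act_int_smult[of v n _ n])
    finally show ?thesis
      using d[OF Z_basis_row_act_mem[OF v U(1) that]] by simp
  qed
  from Z_basis_mult_mem[OF v additive_group_scale[OF I] this]
  have "z ^ Suc j - z ^ Suc i \<in> mult_into I {a * x | x. x \<in> I}"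
    by (rule mult_intoI)
  then have "z ^ (Suc i + (j - i)) - z ^ Suc i \<in> mult_into I {a * x | x. x \<in> I}"
    using ij by simp
  then show ?thesis
    using idempotent_power_of_repeated_power[OF z, of "Suc i" "j - i"] ij by simp
qed

text \<open>A coefficient of an element of \<open>X\<close> can be absorbed into \<open>I\<close>, so only the generators \<open>g\<close> of \<open>X\<close> have
  to be tested to control \<open>J = I X\<close>.\<close>
lemma mult_mem_via_generators:
  assumes L: "additive_group L" and J: "J = module_prod I X"
    and X: "X = {\<Sum>g\<in>G. s g * g | s. \<forall>g\<in>G. s g \<in> mult_into I I}"
    and c: "\<And>g u. g \<in> G \<Longrightarrow> u \<in> I \<Longrightarrow> (c * g) * u \<in> L" and w: "w \<in> J"
  shows "c * w \<in> L"
  using w unfolding J module_prod_def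
proof (rule group_closure_mult_mem[OF L, rotated])
  fix t assume "t \<in> {u * x | u x. u \<in> I \<and> x \<in> X}"
  then obtain u s where u: "u \<in> I" and s: "\<forall>g\<in>G. s g \<in> mult_into I I"
    and t: "t = u * (\<Sum>g\<in>G. s g * g)"
    unfolding X by blast
  have "c * t = (\<Sum>g\<in>G. (c * g) * (s g * u))"
    by (simp add: t sum_distrib_left mult_ac)
  also have "\<dots> \<in> L"
    using s u by (intro additive_group_sum[OF L] c) (auto intro: mult_intoD)
  finally show "c * t \<in> L" .
qed

section \<open>Multipliers between weakly equivalent ideals\<close>

text \<open>Multipliers of \<open>I\<close> into \<open>J\<close> and back that are inverse to each other modulo \<open>a\<close>. From
  \<open>I = J Y = (I X) Y\<close> it follows that the products of generators of \<open>X\<close> and \<open>Y\<close> detect membership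
  in the multipliers into \<open>a I\<close>, which is what \<open>product_congruent_to_one\<close> asks for. The congruence
  passes from \<open>I\<close> to \<open>J = I X\<close> by multiplying with \<open>X\<close>.\<close>
lemma weakly_equivalent_multipliers:
  assumes v: "Z_basis v I" "v \<in> carrier_vec n" and I: "additive_group I"
    and "d \<noteq> 0" and d: "\<And>x. x \<in> I \<Longrightarrow> of_int d * x \<in> {a * x | x. x \<in> I}"
    and S: "S = mult_into I I" "S = mult_into J J"
    and weq: "weakly_equivalent \<beta> S I J"
  obtains x y where "x \<in> mult_into I J" "y \<in> mult_into J I"
    "1 - x * y \<in> mult_into I {a * u | u. u \<in> I}" "1 - x * y \<in> mult_into J {a * w | w. w \<in> J}"
proof -
  interpret subring_with_ideal S "mult_into I {a * u | u. u \<in> I}"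
    unfolding S(1) by (rule subring_with_ideal_multipliers[OF I])
  obtain X Y G H where G: "finite G" and X: "X = {\<Sum>g\<in>G. c g * g | c. \<forall>g\<in>G. c g \<in> S}"
    and H: "finite H" and Y: "Y = {\<Sum>h\<in>H. c h * h | c. \<forall>h\<in>H. c h \<in> S}"
    and J: "J = module_prod I X" and IJ: "I = module_prod J Y"
    using weq by (auto simp: weakly_equivalent_def fg_module_def)
  have XI: "X \<subseteq> mult_into I J" and YJ: "Y \<subseteq> mult_into J I"
  proof -
    have ux: "u * x \<in> J" if "u \<in> I" "x \<in> X" for u x
      using that by (subst J, unfold module_prod_def, blast intro: group_closure.base)
    have wy: "w * y \<in> I" if "w \<in> J" "y \<in> Y" for w y
      using that by (subst IJ, unfold module_prod_def, blast intro: group_closure.base)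
    show "X \<subseteq> mult_into I J"
      by (intro subsetI mult_intoI, subst mult.commute) (rule ux)
    show "Y \<subseteq> mult_into J I"
      by (intro subsetI mult_intoI, subst mult.commute) (rule wy)
  qed
  have Jgrp: "additive_group J"
    by (simp add: J module_prod_def additive_group_group_closure)
  have L: "additive_group {a * u | u. u \<in> I}" "additive_group {a * w | w. w \<in> J}"
    by (rule additive_group_scale[OF I], rule additive_group_scale[OF Jgrp])
  have submod: "submodule X" "submodule Y"
    unfolding X Y by (rule span_submodule)+
  have gens: "G \<subseteq> X" "H \<subseteq> Y"
    unfolding X Y by (rule span_superset[OF G], rule span_superset[OF H])
  have XY: "x * y \<in> S" if "x \<in> X" "y \<in> Y" for x y
  proof -
    have "y * (x * u) \<in> I" if "u \<in> I" for u
      using XI YJ \<open>x \<in> X\<close> \<open>y \<in> Y\<close> that by (auto simp: mult_into_def)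
    then show ?thesis
      by (simp add: S(1) mult_into_def mult_ac)
  qed
  obtain x y where xy: "x \<in> X" "y \<in> Y" "1 - x * y \<in> mult_into I {a * u | u. u \<in> I}"
  proof (rule product_congruent_to_one[OF submod XY _ G gens(1) H gens(2)])
    show "\<exists>N>0. z ^ N * z ^ N - z ^ N \<in> mult_into I {a * u | u. u \<in> I}" if "z \<in> S" for z
      using idempotent_power_multiplier[OF v I \<open>d \<noteq> 0\<close> d] that by (simp add: S(1))
  next
    fix c assume c: "\<And>g h. g \<in> G \<Longrightarrow> h \<in> H \<Longrightarrow> c * (g * h) \<in> mult_into I {a * u | u. u \<in> I}"
    show "c \<in> mult_into I {a * u | u. u \<in> I}"
    proof (rule mult_intoI)
      fix u assume "u \<in> I"
      show "c * u \<in> {a * u | u. u \<in> I}"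
      proof (rule mult_mem_via_generators[OF L(1) IJ Y[unfolded S(2)] _ \<open>u \<in> I\<close>])
        fix h w assume h: "h \<in> H" and "w \<in> J"
        show "(c * h) * w \<in> {a * u | u. u \<in> I}"
        proof (rule mult_mem_via_generators[OF L(1) J X[unfolded S(1)] _ \<open>w \<in> J\<close>])
          fix g u assume "g \<in> G" "u \<in> I"
          then have "(c * (g * h)) * u \<in> {a * u | u. u \<in> I}"
            by (intro mult_intoD[OF c[OF _ h]])
          moreover have "((c * h) * g) * u = (c * (g * h)) * u"
            by (simp add: mult_ac)
          ultimately show "((c * h) * g) * u \<in> {a * u | u. u \<in> I}"
            by (simp only:)
        qed
      qed
    qed
  qed
  have "1 - x * y \<in> mult_into J {a * w | w. w \<in> J}"
  proof (rule mult_intoI)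
    fix w assume "w \<in> J"
    show "(1 - x * y) * w \<in> {a * w | w. w \<in> J}"
    proof (rule mult_mem_via_generators[OF L(2) J X[unfolded S(1)] _ \<open>w \<in> J\<close>])
      fix g u assume "g \<in> G" "u \<in> I"
      then obtain u' where "u' \<in> I" "(1 - x * y) * u = a * u'"
        using mult_intoD[OF xy(3)] by blast
      moreover have "g * u' \<in> J"
        using gens(1) XI \<open>g \<in> G\<close> \<open>u' \<in> I\<close> by (auto intro: mult_intoD)
      ultimately show "((1 - x * y) * g) * u \<in> {a * w | w. w \<in> J}"
        by (auto simp: mult_ac intro!: exI[of _ "g * u'"])
    qed
  qed
  then show ?thesis
    using that xy XI YJ by blast
qed

section \<open>Matrices of multipliers\<close>

lemma associated_idealE:
  assumes "A \<in> carrier_mat n n" and "associated_ideal \<beta> A I"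
  obtains v where "v \<in> carrier_vec n" "v \<noteq> 0\<^sub>v n" "row_act v A = \<beta> \<cdot>\<^sub>v v" "Z_basis v I" "I \<subseteq> Q_field \<beta>"
  using assms by (auto simp: associated_ideal_def fractional_ideal_def eigenvector_def row_act_def)

lemma Z_basis_coeff_ring:
  assumes v: "Z_basis v I" "v \<in> carrier_vec n" "v \<noteq> 0\<^sub>v n" and "I \<subseteq> Q_field \<beta>"
  shows "coeff_ring \<beta> I = mult_into I I"
proof -
  obtain i where i: "i < n" "v $ i \<noteq> 0"
    using v(2,3) by (metis carrier_vecD eq_vecI index_zero_vec)
  show ?thesis
    using coeff_ring_eq_mult_into[OF assms(4) Z_basis_vec_mem[OF v(1,2) i(1)] i(2)] .
qed

lemma multiplication_matrix:
  assumes v: "Z_basis v I" "v \<in> carrier_vec n" and w: "Z_basis w J" "w \<in> carrier_vec m"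
    and x: "x \<in> mult_into I J"
  obtains M where "M \<in> carrier_mat m n" "row_act w M = x \<cdot>\<^sub>v v"
proof (rule Z_basis_obtain_matrix[OF w, of "x \<cdot>\<^sub>v v" n])
  show "(x \<cdot>\<^sub>v v) $ j \<in> J" if "j < n" for j
    using mult_intoD[OF x Z_basis_vec_mem[OF v that]] that v(2) by simp
qed (use v(2) that in auto)

text \<open>From \<open>G adj(G) = det(G)\<close> and \<open>v G = a v\<close> one gets \<open>det(G) v = a (v adj(G))\<close>: the number \<open>a\<close>
  divides the integer \<open>det(G)\<close> among the multipliers of \<open>I\<close>.\<close>
lemma det_mult_mem:
  assumes v: "Z_basis v I" "v \<in> carrier_vec n" and G: "G \<in> carrier_mat n n"
    and eig: "row_act v G = a \<cdot>\<^sub>v v" and x: "x \<in> I"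
  shows "of_int (det G) * x \<in> {a * u | u. u \<in> I}"
proof (rule Z_basis_mult_mem[OF v additive_group_scale[OF Z_basis_additive_group[OF v(1)]] _ x])
  fix i assume i: "i < n"
  note adj = adj_mat[OF G]
  have "of_int (det G) \<cdot>\<^sub>v v = row_act v (G * adj_mat G)"
    using v(2) by (simp add: adj(2) row_act_int_smult[of v n _ n] row_act_one)
  also have "\<dots> = a \<cdot>\<^sub>v row_act v (adj_mat G)"
    using v(2) G adj(1) by (simp add: row_act_mult[of v n _ n _ n] eig row_act_scale[of v n _ n])
  finally have "(of_int (det G) \<cdot>\<^sub>v v) $ i = (a \<cdot>\<^sub>v row_act v (adj_mat G)) $ i"
    by simp
  then have "of_int (det G) * v $ i = a * row_act v (adj_mat G) $ i"
    using i v(2) adj(1) by simp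
  with Z_basis_row_act_mem[OF v adj(1) i] show "of_int (det G) * v $ i \<in> {a * u | u. u \<in> I}"
    by blast
qed

lemma eigenvalue_nonzero_if_det_nonzero:
  assumes v: "Z_basis v I" "v \<in> carrier_vec n" "v \<noteq> 0\<^sub>v n" and G: "G \<in> carrier_mat n n"
    and eig: "row_act v G = a \<cdot>\<^sub>v v" and "det G \<noteq> 0"
  shows "a \<noteq> 0"
proof
  assume "a = 0"
  then have "of_int (det G) * v $ i = 0" if "i < n" for i
    using det_mult_mem[OF v(1,2) G eig Z_basis_vec_mem[OF v(1,2) that]] by auto
  with \<open>det G \<noteq> 0\<close> v(2,3) show False
    by (auto intro!: eq_vecI)
qed

text \<open>The quotient \<open>(c - 1) / a\<close> is a multiplier of \<open>I\<close>, and \<open>U\<close> is its matrix. As a multiplier it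
  commutes with \<open>a\<close>, so that \<open>U\<close> can be placed to the left of \<open>G\<close>; this is the side on which
  \<open>m U G\<close> lies in the row lattice of \<open>G\<close>.\<close>
lemma matrix_congruent_to_one:
  assumes v: "Z_basis v I" "v \<in> carrier_vec n" and G: "G \<in> carrier_mat n n"
    and eig: "row_act v G = a \<cdot>\<^sub>v v" and "a \<noteq> 0"
    and N: "N \<in> carrier_mat n n" "row_act v N = c \<cdot>\<^sub>v v"
    and c: "1 - c \<in> mult_into I {a * u | u. u \<in> I}"
  obtains U where "U \<in> carrier_mat n n" "N = 1\<^sub>m n + U * G"
proof -
  define t where "t = (c - 1) / a"
  have ta: "t * a = c - 1"
    using \<open>a \<noteq> 0\<close> by (simp add: t_def)
  have t: "t \<in> mult_into I I"
  proof (rule mult_intoI)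
    fix u assume "u \<in> I"
    then obtain u' where u': "u' \<in> I" "(1 - c) * u = a * u'"
      using mult_intoD[OF c] by blast
    then have eq: "t * u = 0 - u'"
      using \<open>a \<noteq> 0\<close> by (simp add: t_def field_simps)
    show "t * u \<in> I"
      unfolding eq using u'(1) by (intro additive_groupD(1,2)[OF Z_basis_additive_group[OF v(1)]])
  qed
  obtain U where U: "U \<in> carrier_mat n n" "row_act v U = t \<cdot>\<^sub>v v"
    by (rule multiplication_matrix[OF v v t])
  have "row_act v (1\<^sub>m n + U * G) = v + (t * a) \<cdot>\<^sub>v v"
    using v(2) U G by (simp add: row_act_add[of v n _ n] row_act_one row_act_mult[of v n _ n _ n]
        row_act_scale[of v n _ n] eig smult_smult_assoc)
  also have "\<dots> = row_act v N"
    unfolding ta N(2) using v(2) by (intro eq_vecI) (auto simp: algebra_simps)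
  finally have "N = 1\<^sub>m n + U * G"
    using U G N by (intro Z_basis_row_act_inject[OF v, of _ n]) auto
  with U(1) show ?thesis
    by (rule that)
qed

text \<open>Both \<open>F P\<close> and \<open>P G\<close> send \<open>v\<close> to \<open>b y w\<close>. With \<open>w = v\<close> and \<open>P\<close> a polynomial in \<open>A\<close>, this also
  shows that polynomials in \<open>A\<close> commute.\<close>
lemma eigenvector_row_act_commute:
  assumes v: "Z_basis v I" "v \<in> carrier_vec n" and w: "w \<in> carrier_vec m"
    and P: "P \<in> carrier_mat n m" "row_act v P = y \<cdot>\<^sub>v w"
    and F: "F \<in> carrier_mat n n" "row_act v F = b \<cdot>\<^sub>v v"
    and G: "G \<in> carrier_mat m m" "row_act w G = b \<cdot>\<^sub>v w"
  shows "F * P = P * G"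
proof (rule Z_basis_row_act_inject[OF v, of _ m])
  have "row_act v (F * P) = (b * y) \<cdot>\<^sub>v w"
    using v(2) w P F by (simp add: row_act_mult[of v n _ n _ m] row_act_scale[of v n _ m] smult_smult_assoc)
  also have "\<dots> = row_act v (P * G)"
    using v(2) w P G
    by (simp add: row_act_mult[of v n _ m _ m] row_act_scale[of w m _ m] smult_smult_assoc mult.commute)
  finally show "row_act v (F * P) = row_act v (P * G)" .
qed (use P F G in auto)

section \<open>Bowen--Franks modules\<close>

lemma abelian_group_module_vec: "abelian_group (module_vec TYPE('a::ring_1) n)"
proof (rule abelian_groupI)
  show "\<exists>y\<in>carrier (module_vec TYPE('a) n). y \<oplus>\<^bsub>module_vec TYPE('a) n\<^esub> x = \<zero>\<^bsub>module_vec TYPE('a) n\<^esub>"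
    if "x \<in> carrier (module_vec TYPE('a) n)" for x
    using that by (intro bexI[of _ "- x"]) (auto simp: module_vec_simps)
qed (auto simp: module_vec_simps assoc_add_vec comm_add_vec[of _ n])

lemma row_mult_carrier: "M \<in> carrier_mat n k \<Longrightarrow> row_mult m M \<in> carrier_vec k"
  by (simp add: row_mult_def carrier_vecI)

lemma row_mult_mult:
  assumes "m \<in> carrier_vec n" "M \<in> carrier_mat n l" "N \<in> carrier_mat l k"
  shows "row_mult m (M * N) = row_mult (row_mult m M) N"
  using assms unfolding row_mult_def
  by (simp add: transpose_mult[of _ n l _ k] assoc_mult_mat_vec[of _ k l _ n])

lemma row_mult_add:
  assumes "m \<in> carrier_vec n" "m' \<in> carrier_vec n" "M \<in> carrier_mat n k"
  shows "row_mult (m + m') M = row_mult m M + row_mult m' M"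
  using assms unfolding row_mult_def by (intro mult_add_distrib_mat_vec[of _ k n]) auto

lemma row_mult_add_mat:
  assumes "m \<in> carrier_vec n" "M \<in> carrier_mat n k" "N \<in> carrier_mat n k"
  shows "row_mult m (M + N) = row_mult m M + row_mult m N"
proof -
  have "transpose_mat (M + N) = transpose_mat M + transpose_mat N"
    using assms by (intro transpose_add[of _ n k]) auto
  then show ?thesis
    using assms unfolding row_mult_def by (simp add: add_mult_distrib_mat_vec[of _ k n])
qed

lemma row_mult_one: "m \<in> carrier_vec n \<Longrightarrow> row_mult m (1\<^sub>m n) = m"
  by (simp add: row_mult_def)

lemma row_mult_uminus:
  assumes "m \<in> carrier_vec n" "M \<in> carrier_mat n k"
  shows "row_mult (- m) M = - row_mult m M"
  using assms unfolding row_mult_def by (auto intro!: eq_vecI)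

lemma BF_sub_abelian_subgroup:
  assumes A: "A \<in> carrier_mat n n"
  shows "abelian_subgroup (BF_sub g A) (module_vec TYPE(int) n)"
proof (rule abelian_subgroupI3)
  let ?V = "module_vec TYPE(int) n" and ?M = "poly_mat g A"
  interpret V: abelian_group ?V
    by (rule abelian_group_module_vec)
  have M: "?M \<in> carrier_mat n n" and dim: "dim_row A = n"
    using A by (auto simp: poly_mat_carrier)
  have inv: "\<ominus>\<^bsub>?V\<^esub> x = - x" if "x \<in> carrier_vec n" for x
    using that by (intro V.minus_equality) (auto simp: module_vec_simps)
  show "additive_subgroup (BF_sub g A) ?V"
  proof (rule additive_subgroupI, rule V.add.subgroupI)
    show "BF_sub g A \<subseteq> carrier ?V" "BF_sub g A \<noteq> {}"
      using M by (auto simp: BF_sub_def module_vec_simps row_mult_carrier dim intro: zero_carrier_vec)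
  next
    fix a assume "a \<in> BF_sub g A"
    then obtain m where m: "a = row_mult m ?M" "m \<in> carrier_vec n"
      by (auto simp: BF_sub_def dim)
    then have "\<ominus>\<^bsub>?V\<^esub> a = row_mult (- m) ?M"
      using M by (simp add: inv row_mult_carrier row_mult_uminus)
    then show "\<ominus>\<^bsub>?V\<^esub> a \<in> BF_sub g A"
      using m by (auto simp: BF_sub_def dim)
  next
    fix a b assume "a \<in> BF_sub g A" "b \<in> BF_sub g A"
    then obtain m m' where "a = row_mult m ?M" "m \<in> carrier_vec n"
      "b = row_mult m' ?M" "m' \<in> carrier_vec n"
      by (auto simp: BF_sub_def dim)
    then show "a \<oplus>\<^bsub>?V\<^esub> b \<in> BF_sub g A"
      using M by (auto simp: BF_sub_def dim module_vec_simps row_mult_add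
        intro!: exI[of _ "m + m'"])
  qed
qed (rule abelian_group_module_vec)

text \<open>The map of cosets induced by \<open>m \<mapsto> m P\<close>. As a union over representatives it is defined on all
  sets and commutes with unions. For \<open>P = f(B)\<close> it is the action of \<open>f\<close> on the module of \<open>B\<close>,
  whose scalar multiplication is such a union over the elements \<open>f\<close> of a class of polynomials.\<close>
definition coset_map :: "int poly \<Rightarrow> int mat \<Rightarrow> int mat \<Rightarrow> int vec set \<Rightarrow> int vec set" where
  "coset_map g B P C =
     (\<Union>m\<in>C. BF_sub g B +>\<^bsub>module_vec TYPE(int) (dim_row B)\<^esub> row_mult m P)"

text \<open>The map is well defined on cosets because \<open>k g(A) P = (k P) g(B)\<close> lies in the row lattice of
  \<open>g(B)\<close>.\<close>
lemma coset_map_coset: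
  assumes A: "A \<in> carrier_mat n n" and B: "B \<in> carrier_mat n n" and P: "P \<in> carrier_mat n n"
    and comm: "poly_mat g A * P = P * poly_mat g B" and m: "m \<in> carrier_vec n"
  shows "coset_map g B P (BF_sub g A +>\<^bsub>module_vec TYPE(int) n\<^esub> m)
    = BF_sub g B +>\<^bsub>module_vec TYPE(int) n\<^esub> row_mult m P"
proof -
  let ?V = "module_vec TYPE(int) n"
  interpret HA: abelian_subgroup "BF_sub g A" ?V
    by (rule BF_sub_abelian_subgroup[OF A])
  interpret HB: abelian_subgroup "BF_sub g B" ?V
    by (rule BF_sub_abelian_subgroup[OF B])
  note gA = poly_mat_carrier[OF A, of g] and gB = poly_mat_carrier[OF B, of g]
  have "BF_sub g B +>\<^bsub>?V\<^esub> row_mult m' P = BF_sub g B +>\<^bsub>?V\<^esub> row_mult m P"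
    if m': "m' \<in> BF_sub g A +>\<^bsub>?V\<^esub> m" for m'
  proof -
    obtain k where k: "k \<in> carrier_vec n" "m' = row_mult k (poly_mat g A) + m"
      using m' A by (auto simp: a_r_coset_def' BF_sub_def module_vec_simps)
    have "row_mult m' P = row_mult k (poly_mat g A * P) + row_mult m P"
      using k m P gA by (simp add: row_mult_add[of _ n] row_mult_carrier row_mult_mult[of _ n _ n])
    also have "row_mult k (poly_mat g A * P) = row_mult (row_mult k P) (poly_mat g B)"
      using k P gB by (simp add: comm row_mult_mult[of _ n _ n])
    finally have "row_mult m' P \<in> BF_sub g B +>\<^bsub>?V\<^esub> row_mult m P"
      using B row_mult_carrier[OF P, of k]
      by (auto simp: a_r_coset_def' BF_sub_def module_vec_simps)
    then show ?thesis
      using row_mult_carrier[OF P, of m]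
      by (intro HB.a_repr_independence'[symmetric]) (simp_all add: module_vec_simps)
  qed
  moreover have "m \<in> BF_sub g A +>\<^bsub>?V\<^esub> m"
    using m by (intro HA.a_rcos_self) (simp add: module_vec_simps)
  ultimately show ?thesis
    unfolding coset_map_def carrier_matD(1)[OF B] by (intro SUP_eq_const) (rule notI, simp)
qed

lemma coset_map_UN: "coset_map g B P (\<Union>f\<in>F. C f) = (\<Union>f\<in>F. coset_map g B P (C f))"
  by (auto simp: coset_map_def)

text \<open>Since \<open>P\<close> and \<open>Q\<close> intertwine \<open>g(A)\<close> and \<open>g(B)\<close>, they induce maps between the quotients, which
  are mutually inverse because \<open>m P Q - m = (m U) g(A)\<close> and \<open>m Q P - m = (m W) g(B)\<close> lie in the
  subgroups divided out. Compatibility with scalars holds for each polynomial \<open>f\<close> separately, hence for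
  every set of polynomials, in particular for classes modulo the characteristic polynomial.\<close>
lemma BF_module_isomorphicI:
  assumes A: "A \<in> carrier_mat n n" and B: "B \<in> carrier_mat n n"
    and P: "P \<in> carrier_mat n n" and Q: "Q \<in> carrier_mat n n"
    and U: "U \<in> carrier_mat n n" and W: "W \<in> carrier_mat n n"
    and commA: "\<And>f. poly_mat g A * poly_mat f A = poly_mat f A * poly_mat g A"
    and commB: "\<And>f. poly_mat g B * poly_mat f B = poly_mat f B * poly_mat g B"
    and AP: "\<And>f. poly_mat f A * P = P * poly_mat f B"
    and BQ: "poly_mat g B * Q = Q * poly_mat g A"
    and PQ: "P * Q = 1\<^sub>m n + U * poly_mat g A"
    and QP: "Q * P = 1\<^sub>m n + W * poly_mat g B"
  shows "module_isomorphic R (BF g A) (BF g B)"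
proof -
  let ?V = "module_vec TYPE(int) n" and ?h = "coset_map g B P" and ?k = "coset_map g A Q"
  define cA where "cA m = BF_sub g A +>\<^bsub>?V\<^esub> m" for m
  define cB where "cB m = BF_sub g B +>\<^bsub>?V\<^esub> m" for m
  interpret HA: abelian_subgroup "BF_sub g A" ?V
    by (rule BF_sub_abelian_subgroup[OF A])
  interpret HB: abelian_subgroup "BF_sub g B" ?V
    by (rule BF_sub_abelian_subgroup[OF B])
  have dims: "dim_row A = n" "dim_row B = n"
    using A B by auto
  have carA: "carrier (BF g A) = cA ` carrier_vec n" and carB: "carrier (BF g B) = cB ` carrier_vec n"
    by (auto simp: BF_def dims Let_def A_RCOSETS_def' cA_def cB_def module_vec_simps)
  have PV: "row_mult m P \<in> carrier_vec n" and QV: "row_mult m Q \<in> carrier_vec n" for m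
    using P Q by (auto intro: row_mult_carrier)
  have fA: "poly_mat f A \<in> carrier_mat n n" and fB: "poly_mat f B \<in> carrier_mat n n" for f
    using A B by (auto intro: poly_mat_carrier)
  have h: "?h (cA m) = cB (row_mult m P)" if "m \<in> carrier_vec n" for m
    unfolding cA_def cB_def using coset_map_coset[OF A B P AP that] .
  have k: "?k (cB m) = cA (row_mult m Q)" if "m \<in> carrier_vec n" for m
    unfolding cA_def cB_def using coset_map_coset[OF B A Q BQ that] .
  have kh: "?k (?h (cA m)) = cA m" if m: "m \<in> carrier_vec n" for m
  proof -
    have "row_mult (row_mult m P) Q = row_mult (row_mult m U) (poly_mat g A) + m"
      using m P Q U fA[of g] row_mult_carrier[OF U, of m]
      by (simp add: row_mult_mult[of _ n _ n, symmetric] PQ row_mult_add_mat[of _ n _ n] row_mult_one)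
        (intro comm_add_vec[of _ n] row_mult_carrier[of _ n] mult_carrier_mat[of _ n n]; simp)
    then have "row_mult (row_mult m P) Q \<in> cA m"
      using row_mult_carrier[OF U, of m]
      by (auto simp: cA_def a_r_coset_def' BF_sub_def dims module_vec_simps)
    then have "cA (row_mult (row_mult m P) Q) = cA m"
      unfolding cA_def using m by (intro HA.a_repr_independence'[symmetric]) (simp_all add: module_vec_simps)
    then show ?thesis
      using m PV by (simp add: h k)
  qed
  have hk: "?h (?k (cB m)) = cB m" if m: "m \<in> carrier_vec n" for m
  proof -
    have "row_mult (row_mult m Q) P = row_mult (row_mult m W) (poly_mat g B) + m"
      using m P Q W fB[of g] row_mult_carrier[OF W, of m]
      by (simp add: row_mult_mult[of _ n _ n, symmetric] QP row_mult_add_mat[of _ n _ n] row_mult_one)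
        (intro comm_add_vec[of _ n] row_mult_carrier[of _ n] mult_carrier_mat[of _ n n]; simp)
    then have "row_mult (row_mult m Q) P \<in> cB m"
      using row_mult_carrier[OF W, of m]
      by (auto simp: cB_def a_r_coset_def' BF_sub_def dims module_vec_simps)
    then have "cB (row_mult (row_mult m Q) P) = cB m"
      unfolding cB_def using m by (intro HB.a_repr_independence'[symmetric]) (simp_all add: module_vec_simps)
    then show ?thesis
      using m QV by (simp add: h k)
  qed
  have bij: "bij_betw ?h (carrier (BF g A)) (carrier (BF g B))"
    by (rule bij_betw_byWitness[where f' = ?k]) (auto simp: carA carB kh hk, auto simp: h k PV QV)
  have add: "?h (cA m \<oplus>\<^bsub>BF g A\<^esub> cA m') = ?h (cA m) \<oplus>\<^bsub>BF g B\<^esub> ?h (cA m')"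
    if m: "m \<in> carrier_vec n" "m' \<in> carrier_vec n" for m m'
  proof -
    have "cA m \<oplus>\<^bsub>BF g A\<^esub> cA m' = cA (m + m')"
      using HA.a_rcos_sum[of m m'] m by (simp add: BF_def dims Let_def cA_def module_vec_simps)
    moreover have "cB (row_mult m P) \<oplus>\<^bsub>BF g B\<^esub> cB (row_mult m' P) = cB (row_mult m P + row_mult m' P)"
      using HB.a_rcos_sum[of "row_mult m P" "row_mult m' P"] PV
      by (simp add: BF_def dims Let_def cB_def module_vec_simps)
    ultimately show ?thesis
      using m P by (simp add: h row_mult_add[of _ n])
  qed
  have smult: "?h (F \<odot>\<^bsub>BF g A\<^esub> cA m) = F \<odot>\<^bsub>BF g B\<^esub> ?h (cA m)" if m: "m \<in> carrier_vec n" for m F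
  proof -
    have "F \<odot>\<^bsub>BF g A\<^esub> cA m = (\<Union>f\<in>F. coset_map g A (poly_mat f A) (cA m))"
      by (simp add: BF_def dims Let_def coset_map_def)
    also have "\<dots> = (\<Union>f\<in>F. cA (row_mult m (poly_mat f A)))"
      unfolding cA_def using coset_map_coset[OF A A fA commA m] by simp
    finally have "?h (F \<odot>\<^bsub>BF g A\<^esub> cA m) = (\<Union>f\<in>F. cB (row_mult (row_mult m (poly_mat f A)) P))"
      using row_mult_carrier[OF fA] by (simp add: coset_map_UN h)
    also have "\<dots> = (\<Union>f\<in>F. cB (row_mult (row_mult m P) (poly_mat f B)))"
      using row_mult_mult[OF m fA P] row_mult_mult[OF m P fB] AP by simp
    also have "\<dots> = (\<Union>f\<in>F. coset_map g B (poly_mat f B) (cB (row_mult m P)))"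
      unfolding cB_def using coset_map_coset[OF B B fB commB PV] by simp
    also have "\<dots> = F \<odot>\<^bsub>BF g B\<^esub> ?h (cA m)"
      unfolding h[OF m] by (simp add: BF_def dims Let_def coset_map_def)
    finally show ?thesis .
  qed
  have "?h \<in> LinearCombinations.module_hom R (BF g A) (BF g B)"
    unfolding LinearCombinations.module_hom_def
    using bij_betw_imp_funcset[OF bij] add smult by (auto simp: carA)
  with bij show ?thesis
    unfolding module_isomorphic_def by blast
qed

section \<open>Weak equivalence implies strong BF-equivalence\<close>

theorem theorem4p2:
  fixes n :: nat and A B :: "int mat" and p :: "int poly"
    and \<beta> :: complex and I J S :: "complex set"
  assumes "A \<in> GL_int n" and "B \<in> GL_int n"
    and "hyperbolic A" and "hyperbolic B"
    and "char_poly A = p" and "char_poly B = p" and "irreducible p"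
    and "poly (map_poly of_int p) \<beta> = 0"
    and "associated_ideal \<beta> A I" and "associated_ideal \<beta> B J"
    and "coeff_ring \<beta> I = S" and "coeff_ring \<beta> J = S"
    and "weakly_equivalent \<beta> S I J"
  shows "strongly_BF_equivalent p A B"
  unfolding strongly_BF_equivalent_def
proof (intro allI impI)
  fix g assume det: "det (poly_mat g A) \<noteq> 0"
  have A: "A \<in> carrier_mat n n" and B: "B \<in> carrier_mat n n"
    using assms(1,2) by (simp_all add: GL_int_def)
  obtain v where v: "v \<in> carrier_vec n" "v \<noteq> 0\<^sub>v n" "row_act v A = \<beta> \<cdot>\<^sub>v v"
    and vI: "Z_basis v I" "I \<subseteq> Q_field \<beta>"
    by (rule associated_idealE[OF A assms(9)])
  obtain w where w: "w \<in> carrier_vec n" "w \<noteq> 0\<^sub>v n" "row_act w B = \<beta> \<cdot>\<^sub>v w"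
    and wJ: "Z_basis w J" "J \<subseteq> Q_field \<beta>"
    by (rule associated_idealE[OF B assms(10)])
  let ?e = "\<lambda>f. poly (map_poly of_int f) \<beta>"
  note fA = poly_mat_carrier[OF A] and fB = poly_mat_carrier[OF B]
  note eA = row_act_poly_mat[OF A v(1,3)] and eB = row_act_poly_mat[OF B w(1,3)]
  have a: "?e g \<noteq> 0"
    by (rule eigenvalue_nonzero_if_det_nonzero[OF vI(1) v(1,2) fA eA det])
  have S: "S = mult_into I I" "S = mult_into J J"
    using Z_basis_coeff_ring[OF vI(1) v(1,2) vI(2)] Z_basis_coeff_ring[OF wJ(1) w(1,2) wJ(2)]
      assms(11,12) by simp_all
  obtain x y where x: "x \<in> mult_into I J" and y: "y \<in> mult_into J I"
    and xy: "1 - x * y \<in> mult_into I {?e g * u | u. u \<in> I}" "1 - x * y \<in> mult_into J {?e g * u | u. u \<in> J}"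
    by (rule weakly_equivalent_multipliers[OF vI(1) v(1) Z_basis_additive_group[OF vI(1)] det
        det_mult_mem[OF vI(1) v(1) fA eA] S assms(13)])
  obtain P where P: "P \<in> carrier_mat n n" "row_act v P = y \<cdot>\<^sub>v w"
    by (rule multiplication_matrix[OF wJ(1) w(1) vI(1) v(1) y])
  obtain Q where Q: "Q \<in> carrier_mat n n" "row_act w Q = x \<cdot>\<^sub>v v"
    by (rule multiplication_matrix[OF vI(1) v(1) wJ(1) w(1) x])
  have PQ: "row_act v (P * Q) = (x * y) \<cdot>\<^sub>v v" and QP: "row_act w (Q * P) = (x * y) \<cdot>\<^sub>v w"
    using v(1) w(1) P Q by (simp_all add: row_act_mult[of _ n _ n _ n] row_act_scale[of _ n _ n]
        smult_smult_assoc mult.commute)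
  obtain U where U: "U \<in> carrier_mat n n" "P * Q = 1\<^sub>m n + U * poly_mat g A"
    by (rule matrix_congruent_to_one[OF vI(1) v(1) fA eA a mult_carrier_mat[OF P(1) Q(1)] PQ xy(1)])
  obtain W where W: "W \<in> carrier_mat n n" "Q * P = 1\<^sub>m n + W * poly_mat g B"
    by (rule matrix_congruent_to_one[OF wJ(1) w(1) fB eB a mult_carrier_mat[OF Q(1) P(1)] QP xy(2)])
  show "module_isomorphic (Zx_mod p) (BF g A) (BF g B)"
  proof (rule BF_module_isomorphicI[OF A B P(1) Q(1) U(1) W(1) _ _ _ _ U(2) W(2)])
    fix f
    show "poly_mat g A * poly_mat f A = poly_mat f A * poly_mat g A"
      by (rule eigenvector_row_act_commute[OF vI(1) v(1) v(1) fA eA fA eA fA eA])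
    show "poly_mat g B * poly_mat f B = poly_mat f B * poly_mat g B"
      by (rule eigenvector_row_act_commute[OF wJ(1) w(1) w(1) fB eB fB eB fB eB])
    show "poly_mat f A * P = P * poly_mat f B"
      by (rule eigenvector_row_act_commute[OF vI(1) v(1) w(1) P fA eA fB eB])
  next
    show "poly_mat g B * Q = Q * poly_mat g A"
      by (rule eigenvector_row_act_commute[OF wJ(1) w(1) v(1) Q fB eB fA eA])
  qed
qed

end
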